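(* Let $\gamma>0$, let $n\ge1$ be an integer with $n\gamma<1$, and let $X_1,\dots,X_n$ be i.i.d. random variables with the $\Gamma(\gamma)$ distribution. Let $\alpha\in(1,\infty]$ and let $a_1,\dots,a_n\ge 0$ satisfy $\sum_{j=1}^n a_j=1$. Then $$h_\alpha\left(\sum_{j=1}^n\sqrt{a_j}\,X_j\right)\le h_\alpha\left(\sum_{j=1}^n\frac{1}{\sqrt n}\,X_j\right).$$
   Context: The $\Gamma(\gamma)$ distribution is the distribution on $\mathbb{R}$ with density $\Gamma(\gamma)^{-1}x^{\gamma-1}e^{-x}\mathbf{1}_{(0,\infty)}(x)$. For a random variable $X$ with density $f$ on $\mathbb{R}$ and $\alpha\in(1,\infty)$, the R\'enyi entropy of order $\alpha$ is $h_\alpha(X)=\frac{1}{1-\alpha}\log\int_{\mathbb{R}} f^\alpha$, and $h_\infty(X)=-\log\|f\|_\infty$, where $\|f\|_\infty$ is the essential supremum. These are valued in $[-\infty,\infty)$ or more generally the extended reals, with value $-\infty$ when $\int f^\alpha=+\infty$ (resp. $\|f\|_\infty=+\infty$). *)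

theory Defs
  imports "HOL-Probability.Probability"
begin

definition gamma_density :: "real \<Rightarrow> real \<Rightarrow> real" where
  "gamma_density \<gamma> x =
     (if 0 < x then inverse (Gamma \<gamma>) * x powr (\<gamma> - 1) * exp (- x) else 0)"

definition ln_ennreal :: "ennreal \<Rightarrow> ereal" where
  "ln_ennreal x =
     (if x = 0 then - \<infinity> else if x = \<infinity> then \<infinity> else ereal (ln (enn2real x)))"

text \<open>The Renyi entropy, of order \<open>1 < \<alpha> \<le> \<infinity>\<close>, of a probability density \<open>f\<close> on the real line.
  The integral is extended-valued, so the entropy is \<open>- \<infinity>\<close> if \<open>f\<^sup>\<alpha>\<close> is not integrable, and likewise if
  \<open>f\<close> is essentially unbounded. The totalised value of \<open>enn2real\<close> at \<open>\<infinity>\<close> is harmless: the integral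
  of \<open>f\<close> is 1, hence \<open>f\<close> is finite almost everywhere.\<close>

definition density_renyi_entropy :: "ereal \<Rightarrow> (real \<Rightarrow> ennreal) \<Rightarrow> ereal" where
  "density_renyi_entropy \<alpha> f =
     (if \<alpha> = \<infinity> then - ln_ennreal (esssup lborel f)
      else ereal (1 / (1 - real_of_ereal \<alpha>)) *
             ln_ennreal (\<integral>\<^sup>+ x. ennreal (enn2real (f x) powr real_of_ereal \<alpha>) \<partial>lborel))"

text \<open>The density of \<open>X\<close> is the Radon-Nikodym derivative of its law. It is meaningful only if \<open>X\<close> has a
  density; any density then gives the same value.\<close>

definition renyi_entropy :: "ereal \<Rightarrow> 'a measure \<Rightarrow> ('a \<Rightarrow> real) \<Rightarrow> ereal" where
  "renyi_entropy \<alpha> M X = density_renyi_entropy \<alpha> (RN_deriv lborel (distr M lborel X))"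

lemma density_renyi_entropy_cong_AE:
  assumes "f \<in> borel_measurable lborel" "g \<in> borel_measurable lborel"
    and "AE x in lborel. f x = g x"
  shows "density_renyi_entropy \<alpha> f = density_renyi_entropy \<alpha> g"
proof -
  have "esssup lborel f = esssup lborel g"
    using assms by (intro esssup_AE_cong) auto
  moreover have "(\<integral>\<^sup>+ x. ennreal (enn2real (f x) powr real_of_ereal \<alpha>) \<partial>lborel) =
      (\<integral>\<^sup>+ x. ennreal (enn2real (g x) powr real_of_ereal \<alpha>) \<partial>lborel)"
    using assms(3) by (intro nn_integral_cong_AE) auto
  ultimately show ?thesis
    by (simp add: density_renyi_entropy_def)
qed

lemma renyi_entropy_distributed:
  assumes "distributed M lborel X f"
  shows "renyi_entropy \<alpha> M X = density_renyi_entropy \<alpha> f"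
proof -
  have f: "f \<in> borel_measurable lborel" and d: "density lborel f = distr M lborel X"
    using assms by (auto simp: distributed_def)
  have "AE x in lborel. f x = RN_deriv lborel (distr M lborel X) x"
    by (rule sigma_finite_measure.RN_deriv_unique[OF sigma_finite_lborel f d])
  then show ?thesis
    unfolding renyi_entropy_def
    by (intro density_renyi_entropy_cong_AE[symmetric] f borel_measurable_RN_deriv)
qed

end

theory Submission
  imports Defs "HOL-Real_Asymp.Real_Asymp"
begin

text \<open>
  Write \<open>S\<close> for the weighted sum and \<open>T\<close> for the sum with equal weights, with densities \<open>f\<close> and \<open>g\<close>.
  The argument compares Laplace transforms and turns the comparison into one of \<open>L\<^sup>\<alpha>\<close> norms by duality.

  By independence, the Laplace transform of \<open>S\<close> at \<open>s > 0\<close> is \<open>(\<Prod>j. 1 + s * sqrt (a j)) powr (- \<gamma>)\<close>. The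
  product is largest for equal weights, by the inequality between arithmetic and geometric mean and
  concavity of the square root (\<open>prod_one_plus_sqrt_le\<close>). Hence the Laplace transform of \<open>S\<close>
  dominates that of \<open>T\<close>, and \<open>E (\<phi> S) \<ge> E (\<phi> T)\<close> for every mixture \<open>\<phi>\<close> of decreasing exponentials, that is,
  for every \<open>\<phi>\<close> that is completely monotone on the positive half-line.

  The variable \<open>T\<close> has a gamma law of shape \<open>n * \<gamma>\<close>, so \<open>g x\<close> is a multiple of
  \<open>x powr (n * \<gamma> - 1) * exp (- sqrt n * x)\<close> on the positive half-line. As \<open>n * \<gamma> < 1\<close>, both factors are completely
  monotone, and so is \<open>\<phi> = g powr (\<alpha> - 1)\<close>: it is a mixture of exponentials with gamma weights. Therefore
  \<open>\<integral> f * g powr (\<alpha> - 1) \<ge> \<integral> g powr \<alpha>\<close>, whereas Young's inequality bounds the left side by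
  \<open>(1 / \<alpha>) * \<integral> f powr \<alpha> + (1 - 1 / \<alpha>) * \<integral> g powr \<alpha>\<close>. If \<open>\<integral> g powr \<alpha>\<close> is finite, it cancels and leaves
  \<open>\<integral> g powr \<alpha> \<le> \<integral> f powr \<alpha>\<close>. It may be infinite because of the singularity of \<open>g\<close> at \<open>0\<close>; so
  the argument is run with the translate \<open>g (x + \<epsilon>)\<close> in place of \<open>g x\<close> in the test function
  (\<open>shifted_gamma_norm_le\<close>), and Fatou's lemma takes \<open>\<epsilon>\<close> to \<open>0\<close> (\<open>gamma_norm_le\<close>).

  For \<open>\<alpha> = \<infinity>\<close> the left side is \<open>- \<infinity>\<close>: a density bounded by \<open>K\<close> has Laplace transform at most \<open>K / s\<close>,
  but that of \<open>S\<close> is at least that of \<open>T\<close>, which decays only like \<open>s powr (- n * \<gamma>)\<close>.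
\<close>

section \<open>Gamma densities with a rate parameter\<close>

text \<open>The rate is a parameter, rather than a scaling applied afterwards, because the gamma laws of one
  common rate are closed under convolution.\<close>

definition gamma_rate_density :: "real \<Rightarrow> real \<Rightarrow> real \<Rightarrow> real" where
  "gamma_rate_density \<kappa> c x =
     (if 0 < x then c powr \<kappa> / Gamma \<kappa> * x powr (\<kappa> - 1) * exp (- c * x) else 0)"

lemma gamma_rate_density_measurable [measurable]:
  "gamma_rate_density \<kappa> c \<in> borel_measurable borel"
  unfolding gamma_rate_density_def by measurable

lemma gamma_rate_density_nonneg: "0 < \<kappa> \<Longrightarrow> 0 \<le> gamma_rate_density \<kappa> c x"
  by (auto simp: gamma_rate_density_def Gamma_real_pos intro!: mult_nonneg_nonneg divide_nonneg_pos)

lemma gamma_density_eq_gamma_rate_density: "gamma_density \<gamma> = gamma_rate_density \<gamma> 1"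
  by (auto simp: gamma_density_def gamma_rate_density_def divide_inverse fun_eq_iff)

lemma nn_integral_powr_exp:
  fixes \<kappa> c :: real
  assumes "0 < \<kappa>" "0 < c"
  shows "(\<integral>\<^sup>+x. ennreal (if 0 < x then x powr (\<kappa> - 1) * exp (- c * x) else 0) \<partial>lborel)
       = ennreal (Gamma \<kappa> / c powr \<kappa>)"
proof -
  let ?f = "\<lambda>x::real. ennreal (if 0 < x then x powr (\<kappa> - 1) * exp (- c * x) else 0)"
  have pt: "ennreal (c powr (\<kappa> - 1)) * ?f x
      = ennreal (indicator {0..} (c * x) * (c * x) powr (\<kappa> - 1) / exp (c * x))" for x
    using assms
    by (auto simp: indicator_def powr_mult exp_minus field_simps zero_le_mult_iff
        simp flip: ennreal_mult')
  have "ennreal (Gamma \<kappa>)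
      = ennreal c * (\<integral>\<^sup>+x. ennreal (indicator {0..} (c * x) * (c * x) powr (\<kappa> - 1) / exp (c * x)) \<partial>lborel)"
    unfolding Gamma_conv_nn_integral_real[OF assms(1)]
    by (subst nn_integral_real_affine[where c = c and t = 0]) (use assms in auto)
  also have "\<dots> = ennreal c * (ennreal (c powr (\<kappa> - 1)) * (\<integral>\<^sup>+x. ?f x \<partial>lborel))"
    unfolding pt[symmetric] by (subst nn_integral_cmult) auto
  also have "\<dots> = ennreal (c powr \<kappa>) * (\<integral>\<^sup>+x. ?f x \<partial>lborel)"
    using assms by (simp add: powr_diff mult.assoc[symmetric] ennreal_mult'[symmetric])
  finally have "ennreal (1 / c powr \<kappa>) * ennreal (Gamma \<kappa>)
      = ennreal (1 / c powr \<kappa>) * ennreal (c powr \<kappa>) * (\<integral>\<^sup>+x. ?f x \<partial>lborel)"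
    by (simp add: mult.assoc)
  then show ?thesis
    using assms by (simp flip: ennreal_mult' add: mult.assoc[symmetric])
qed

lemma gamma_rate_density_Laplace:
  assumes "0 < \<kappa>" "0 < c" "0 \<le> s"
  shows "(\<integral>\<^sup>+x. ennreal (exp (- s * x)) * ennreal (gamma_rate_density \<kappa> c x) \<partial>lborel)
       = ennreal ((c / (c + s)) powr \<kappa>)"
proof -
  have "Gamma \<kappa> \<noteq> 0" using Gamma_real_pos[OF assms(1)] by linarith
  have "(\<integral>\<^sup>+x. ennreal (exp (- s * x)) * ennreal (gamma_rate_density \<kappa> c x) \<partial>lborel)
      = (\<integral>\<^sup>+x. ennreal (c powr \<kappa> / Gamma \<kappa>) *
          ennreal (if 0 < x then x powr (\<kappa> - 1) * exp (- (c + s) * x) else 0) \<partial>lborel)"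
    using assms
    by (intro nn_integral_cong)
       (auto simp: gamma_rate_density_def Gamma_real_pos algebra_simps exp_diff exp_minus field_simps exp_add
         simp flip: ennreal_mult')
  also have "\<dots> = ennreal (c powr \<kappa> / Gamma \<kappa>) * ennreal (Gamma \<kappa> / (c + s) powr \<kappa>)"
    using assms nn_integral_powr_exp[of \<kappa> "c + s"] by (subst nn_integral_cmult) auto
  also have "\<dots> = ennreal ((c / (c + s)) powr \<kappa>)"
    using assms \<open>Gamma \<kappa> \<noteq> 0\<close> by (auto simp: powr_divide simp flip: ennreal_mult')
  finally show ?thesis .
qed

text \<open>The exponential factors multiply to \<open>exp (- c * x)\<close>, and the substitution \<open>y = x * t\<close> leaves Euler's
  Beta integral.\<close>

lemma gamma_rate_density_convolution:
  assumes "0 < a" "0 < b" "0 < c"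
  shows "(\<integral>\<^sup>+y. ennreal (gamma_rate_density a c (x - y)) * ennreal (gamma_rate_density b c y) \<partial>lborel)
       = ennreal (gamma_rate_density (a + b) c x)"
proof (cases "0 < x")
  case False
  then have "gamma_rate_density a c (x - y) * gamma_rate_density b c y = 0" for y
    by (auto simp: gamma_rate_density_def)
  then have zero: "ennreal (gamma_rate_density a c (x - y)) * ennreal (gamma_rate_density b c y) = 0" for y
    using assms by (simp add: gamma_rate_density_nonneg flip: ennreal_mult')
  then show ?thesis
    unfolding zero using False by (simp add: gamma_rate_density_def)
next
  case True
  have Gp: "0 < Gamma a" "0 < Gamma b" "0 < Gamma (a + b)"
    using assms by (auto intro: Gamma_real_pos)
  then have Gnz: "Gamma a \<noteq> 0" "Gamma b \<noteq> 0" "Gamma (a + b) \<noteq> 0"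
    by linarith+
  define B where "B = (\<lambda>t::real. t powr (b - 1) * (1 - t) powr (a - 1))"
  define K where "K = c powr (a + b) / (Gamma a * Gamma b) * x powr (a + b - 1) * exp (- c * x)"
  have K0: "0 \<le> K" using Gp by (auto simp: K_def)
  have beta: "(\<integral>\<^sup>+t. ennreal (B t * indicator {0..1} t) \<partial>lborel) = ennreal (Beta b a)"
  proof -
    have "(\<integral>\<^sup>+t. ennreal (B t * indicator {0..1} t) \<partial>lborel)
        = (\<integral>\<^sup>+t. ennreal (indicator {0..1} t * B t) \<partial>lborel)"
      by (simp add: mult.commute)
    also have "\<dots> = ennreal (Beta b a)"
      unfolding B_def
      by (rule nn_integral_has_integral_lebesgue[OF _ has_integral_Beta_real[OF assms(2,1)]]) simp
    finally show ?thesis .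
  qed
  have pt: "ennreal x * (ennreal (gamma_rate_density a c (x - (0 + x * t))) *
        ennreal (gamma_rate_density b c (0 + x * t))) = ennreal K * ennreal (B t * indicator {0..1} t)" for t
  proof (cases "0 < t \<and> t < 1")
    case t: True
    define d where "d = 1 - t"
    have d: "0 < d" "1 - t = d" "x - x * t = x * d"
      using t by (auto simp: d_def algebra_simps)
    have pos: "0 < x * d" "0 < x * t" using t True d by auto
    have e: "exp (- c * (x * d)) * exp (- c * (x * t)) = exp (- c * x)"
      unfolding exp_add[symmetric] d_def by (simp add: algebra_simps)
    have "x * (gamma_rate_density a c (x - x * t) * gamma_rate_density b c (x * t))
        = c powr a * c powr b / (Gamma a * Gamma b) * (x * (x powr (a - 1) * x powr (b - 1)))
          * (d powr (a - 1) * t powr (b - 1)) * (exp (- c * (x * d)) * exp (- c * (x * t)))"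
      unfolding d(3) gamma_rate_density_def using pos d(1) t True by (simp add: powr_mult)
    also have "x * (x powr (a - 1) * x powr (b - 1)) = x powr (a + b - 1)"
      using True by (simp add: powr_add powr_diff)
    finally have "x * (gamma_rate_density a c (x - x * t) * gamma_rate_density b c (x * t)) = K * B t"
      unfolding e K_def B_def d(2) by (simp add: powr_add mult_ac)
    then show ?thesis
      using t True assms K0
      by (simp add: gamma_rate_density_nonneg flip: ennreal_mult')
  next
    case False
    have "gamma_rate_density a c (x - (0 + x * t)) = 0 \<or> gamma_rate_density b c (0 + x * t) = 0"
    proof (cases "t \<le> 0")
      case True
      then show ?thesis using \<open>0 < x\<close> by (auto simp: gamma_rate_density_def zero_less_mult_iff)
    next
      case F: False
      then have "x * 1 \<le> x * t" using \<open>0 < x\<close> False by (intro mult_left_mono) auto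
      then show ?thesis by (auto simp: gamma_rate_density_def)
    qed
    moreover have "B t * indicator {0..1} t = 0"
      using False by (cases "t = 0 \<or> t = 1") (auto simp: B_def indicator_def)
    ultimately show ?thesis by auto
  qed
  have "(\<integral>\<^sup>+y. ennreal (gamma_rate_density a c (x - y)) * ennreal (gamma_rate_density b c y) \<partial>lborel)
      = (\<integral>\<^sup>+t. ennreal x * (ennreal (gamma_rate_density a c (x - (0 + x * t))) *
          ennreal (gamma_rate_density b c (0 + x * t))) \<partial>lborel)"
    using True
    by (subst nn_integral_real_affine[where c = x and t = 0]) (auto simp: nn_integral_cmult)
  also have "\<dots> = ennreal K * ennreal (Beta b a)"
    unfolding pt beta[symmetric] B_def by (subst nn_integral_cmult) auto
  also have "\<dots> = ennreal (gamma_rate_density (a + b) c x)"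
    using True assms Gnz K0
    by (simp add: gamma_rate_density_def K_def Beta_def add.commute flip: ennreal_mult')
  finally show ?thesis .
qed

section \<open>From Laplace transforms to norms\<close>

text \<open>By Euler's integral for \<open>(x + \<epsilon>) powr (- p)\<close>, the test function is a mixture of the exponentials
  \<open>exp (- (s + b) * x)\<close> with nonnegative weights, so Tonelli's theorem reduces the claim to the
  Laplace transforms.\<close>

lemma powr_mixture_mono:
  fixes f g :: "real \<Rightarrow> ennreal"
  assumes [measurable]: "f \<in> borel_measurable borel" "g \<in> borel_measurable borel"
    and f0: "AE x in lborel. x \<le> 0 \<longrightarrow> f x = 0" and g0: "AE x in lborel. x \<le> 0 \<longrightarrow> g x = 0"
    and lap: "\<And>s. 0 < s \<Longrightarrow> (\<integral>\<^sup>+x. ennreal (exp (- s * x)) * g x \<partial>lborel)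
                   \<le> (\<integral>\<^sup>+x. ennreal (exp (- s * x)) * f x \<partial>lborel)"
    and "0 < p" "0 < b" "0 < \<epsilon>"
  shows "(\<integral>\<^sup>+x. ennreal ((x + \<epsilon>) powr (- p) * exp (- b * (x + \<epsilon>))) * g x \<partial>lborel)
       \<le> (\<integral>\<^sup>+x. ennreal ((x + \<epsilon>) powr (- p) * exp (- b * (x + \<epsilon>))) * f x \<partial>lborel)"
proof -
  define w where "w s = (if 0 < s then s powr (p - 1) * exp (- \<epsilon> * s) / Gamma p * exp (- b * \<epsilon>) else 0)" for s
  have w[measurable]: "w \<in> borel_measurable borel" unfolding w_def by measurable
  have Gp: "0 < Gamma p" using \<open>0 < p\<close> by (rule Gamma_real_pos)
  have mix: "ennreal ((x + \<epsilon>) powr (- p) * exp (- b * (x + \<epsilon>)))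
      = (\<integral>\<^sup>+s. ennreal (w s) * ennreal (exp (- (s + b) * x)) \<partial>lborel)" if "0 < x" for x
  proof -
    have "(\<integral>\<^sup>+s. ennreal (w s) * ennreal (exp (- (s + b) * x)) \<partial>lborel)
        = (\<integral>\<^sup>+s. ennreal (exp (- b * (x + \<epsilon>)) / Gamma p) *
             ennreal (if 0 < s then s powr (p - 1) * exp (- (x + \<epsilon>) * s) else 0) \<partial>lborel)"
      using Gp by (intro nn_integral_cong)
        (auto simp: w_def algebra_simps exp_diff exp_minus exp_add field_simps simp flip: ennreal_mult')
    also have "\<dots> = ennreal (exp (- b * (x + \<epsilon>)) / Gamma p) * ennreal (Gamma p / (x + \<epsilon>) powr p)"
      using that assms nn_integral_powr_exp[of p "x + \<epsilon>"] by (subst nn_integral_cmult) auto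
    also have "\<dots> = ennreal ((x + \<epsilon>) powr (- p) * exp (- b * (x + \<epsilon>)))"
      using Gp by (simp add: powr_minus field_simps flip: ennreal_mult')
    finally show ?thesis ..
  qed
  have swap: "(\<integral>\<^sup>+x. ennreal ((x + \<epsilon>) powr (- p) * exp (- b * (x + \<epsilon>))) * h x \<partial>lborel)
      = (\<integral>\<^sup>+s. ennreal (w s) * (\<integral>\<^sup>+x. ennreal (exp (- (s + b) * x)) * h x \<partial>lborel) \<partial>lborel)"
    if [measurable]: "h \<in> borel_measurable borel" and h0: "AE x in lborel. x \<le> 0 \<longrightarrow> h x = 0" for h
  proof -
    have "(\<integral>\<^sup>+x. ennreal ((x + \<epsilon>) powr (- p) * exp (- b * (x + \<epsilon>))) * h x \<partial>lborel)
        = (\<integral>\<^sup>+x. (\<integral>\<^sup>+s. ennreal (w s) * ennreal (exp (- (s + b) * x)) * h x \<partial>lborel) \<partial>lborel)"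
    proof (rule nn_integral_cong_AE, use h0 in eventually_elim)
      case (elim x)
      then show ?case
      proof (cases "0 < x")
        case True
        show ?thesis unfolding mix[OF True] by (subst nn_integral_multc) auto
      qed simp
    qed
    also have "\<dots> = (\<integral>\<^sup>+s. (\<integral>\<^sup>+x. ennreal (w s) * ennreal (exp (- (s + b) * x)) * h x \<partial>lborel) \<partial>lborel)"
      by (rule lborel_pair.Fubini') simp
    also have "\<dots> = (\<integral>\<^sup>+s. ennreal (w s) * (\<integral>\<^sup>+x. ennreal (exp (- (s + b) * x)) * h x \<partial>lborel) \<partial>lborel)"
      by (simp add: mult.assoc nn_integral_cmult)
    finally show ?thesis .
  qed
  show ?thesis
    unfolding swap[OF assms(1) f0] swap[OF assms(2) g0]
  proof (rule nn_integral_mono)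
    fix s :: real
    show "ennreal (w s) * (\<integral>\<^sup>+x. ennreal (exp (- (s + b) * x)) * g x \<partial>lborel)
        \<le> ennreal (w s) * (\<integral>\<^sup>+x. ennreal (exp (- (s + b) * x)) * f x \<partial>lborel)"
      by (cases "0 < s") (use lap[of "s + b"] \<open>0 < b\<close> in \<open>auto simp: w_def intro: mult_left_mono\<close>)
  qed
qed

text \<open>With \<open>G\<close> the gamma density, \<open>A\<close> the left side and \<open>B\<close> the right side, and \<open>\<phi> x = G (x + \<epsilon>) powr (r - 1)\<close>,
  the chain is \<open>A \<le> \<integral> \<phi> * G \<le> \<integral> \<phi> * f \<le> B / r + (1 - 1 / r) * A\<close>. The steps are that \<open>G\<close> decreases, that \<open>\<phi>\<close> is
  completely monotone since \<open>\<kappa> < 1\<close>, and Young's inequality. The shift makes \<open>\<phi>\<close> bounded on the positive half-line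
  and hence \<open>A\<close> finite, so that \<open>A\<close> can be cancelled.\<close>

lemma shifted_gamma_norm_le:
  fixes f :: "real \<Rightarrow> ennreal"
  assumes [measurable]: "f \<in> borel_measurable borel"
    and f0: "AE x in lborel. x \<le> 0 \<longrightarrow> f x = 0" and fin: "AE x in lborel. f x \<noteq> \<infinity>"
    and \<kappa>: "0 < \<kappa>" "\<kappa> < 1" and c: "0 < c" and r: "1 < r" and \<epsilon>: "0 < \<epsilon>"
    and lap: "\<And>s. 0 < s \<Longrightarrow> ennreal ((c / (c + s)) powr \<kappa>) \<le> (\<integral>\<^sup>+x. ennreal (exp (- s * x)) * f x \<partial>lborel)"
  shows "(\<integral>\<^sup>+x. ennreal (if 0 < x then gamma_rate_density \<kappa> c (x + \<epsilon>) powr r else 0) \<partial>lborel)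
       \<le> (\<integral>\<^sup>+x. ennreal (enn2real (f x) powr r) \<partial>lborel)"
    (is "?A \<le> ?B")
proof -
  define G where "G = gamma_rate_density \<kappa> c"
  have G_nonneg: "0 \<le> G x" for x unfolding G_def using \<kappa>(1) by (rule gamma_rate_density_nonneg)
  have [measurable]: "G \<in> borel_measurable borel" unfolding G_def by simp
  define K where "K = c powr \<kappa> / Gamma \<kappa>"
  have K: "0 < K" using \<kappa> c by (auto simp: K_def Gamma_real_pos)
  have G_pos: "G x = K * x powr (\<kappa> - 1) * exp (- c * x)" if "0 < x" for x
    using that by (simp add: G_def K_def gamma_rate_density_def)
  have G_antimono: "G y \<le> G x" if "0 < x" "x \<le> y" for x y
    using that \<kappa> K c by (simp add: G_pos) (intro mult_mono powr_mono2'; simp)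
  let ?\<phi> = "\<lambda>x. ennreal (G (x + \<epsilon>) powr (r - 1))"
  have \<phi>_eq: "?\<phi> x = ennreal (K powr (r - 1)) * ennreal ((x + \<epsilon>) powr (- ((1 - \<kappa>) * (r - 1)))
        * exp (- (c * (r - 1)) * (x + \<epsilon>)))" if "0 < x" for x
  proof -
    have "G (x + \<epsilon>) powr (r - 1) = K powr (r - 1) * ((x + \<epsilon>) powr (- ((1 - \<kappa>) * (r - 1)))
        * exp (- (c * (r - 1)) * (x + \<epsilon>)))"
      using that \<epsilon> K by (simp add: G_pos powr_mult powr_powr exp_powr_real algebra_simps)
    then show ?thesis by (simp flip: ennreal_mult')
  qed
  have comp: "(\<integral>\<^sup>+x. ?\<phi> x * ennreal (G x) \<partial>lborel) \<le> (\<integral>\<^sup>+x. ?\<phi> x * f x \<partial>lborel)"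
  proof -
    let ?e = "\<lambda>x. ennreal ((x + \<epsilon>) powr (- ((1 - \<kappa>) * (r - 1))) * exp (- (c * (r - 1)) * (x + \<epsilon>)))"
    have G0: "AE x in lborel. x \<le> 0 \<longrightarrow> ennreal (G x) = 0"
      by (auto simp: G_def gamma_rate_density_def)
    have le: "(\<integral>\<^sup>+x. ?e x * ennreal (G x) \<partial>lborel) \<le> (\<integral>\<^sup>+x. ?e x * f x \<partial>lborel)"
    proof (rule powr_mixture_mono[OF _ _ f0 G0])
      fix s :: real assume "0 < s"
      then show "(\<integral>\<^sup>+x. ennreal (exp (- s * x)) * ennreal (G x) \<partial>lborel)
          \<le> (\<integral>\<^sup>+x. ennreal (exp (- s * x)) * f x \<partial>lborel)"
        unfolding G_def using gamma_rate_density_Laplace[of \<kappa> c s] \<kappa> c lap[of s] by simp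
    qed (use \<kappa> c r \<epsilon> in auto)
    have eq: "(\<integral>\<^sup>+x. ?\<phi> x * h x \<partial>lborel) = ennreal (K powr (r - 1)) * (\<integral>\<^sup>+x. ?e x * h x \<partial>lborel)"
      if [measurable]: "h \<in> borel_measurable borel" and h0: "AE x in lborel. x \<le> 0 \<longrightarrow> h x = 0" for h
    proof -
      have "(\<integral>\<^sup>+x. ?\<phi> x * h x \<partial>lborel) = (\<integral>\<^sup>+x. ennreal (K powr (r - 1)) * (?e x * h x) \<partial>lborel)"
      proof (rule nn_integral_cong_AE, use h0 in eventually_elim)
        case (elim x)
        then show ?case by (cases "0 < x") (auto simp: \<phi>_eq mult.assoc)
      qed
      then show ?thesis by (simp add: nn_integral_cmult)
    qed
    show ?thesis
      unfolding eq[OF assms(1) f0] using eq[OF _ G0] le by (simp add: mult_left_mono)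
  qed
  have A_le: "?A \<le> (\<integral>\<^sup>+x. ?\<phi> x * ennreal (G x) \<partial>lborel)"
  proof (rule nn_integral_mono)
    fix x :: real
    show "ennreal (if 0 < x then gamma_rate_density \<kappa> c (x + \<epsilon>) powr r else 0) \<le> ?\<phi> x * ennreal (G x)"
    proof (cases "0 < x")
      case True
      have "0 < G (x + \<epsilon>)" using True \<epsilon> K by (simp add: G_pos)
      then have "G (x + \<epsilon>) powr r = G (x + \<epsilon>) powr (r - 1) * G (x + \<epsilon>)"
        by (simp add: powr_diff)
      also have "\<dots> \<le> G (x + \<epsilon>) powr (r - 1) * G x"
        using True \<epsilon> by (intro mult_left_mono G_antimono) auto
      finally show ?thesis
        using True by (simp add: G_def ennreal_leI flip: ennreal_mult')
    qed auto
  qed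
  have A_fin: "?A < \<infinity>"
  proof -
    have "(\<integral>\<^sup>+x. ?\<phi> x * ennreal (G x) \<partial>lborel)
        \<le> (\<integral>\<^sup>+x. ennreal (G \<epsilon> powr (r - 1)) * ennreal (G x) \<partial>lborel)"
    proof (rule nn_integral_mono)
      fix x :: real
      show "?\<phi> x * ennreal (G x) \<le> ennreal (G \<epsilon> powr (r - 1)) * ennreal (G x)"
      proof (cases "0 < x")
        case True
        then show ?thesis
          using \<epsilon> r by (intro mult_right_mono ennreal_leI powr_mono2 G_antimono G_nonneg) auto
      qed (simp add: G_def gamma_rate_density_def)
    qed
    also have "\<dots> = ennreal (G \<epsilon> powr (r - 1)) * (\<integral>\<^sup>+x. ennreal (G x) \<partial>lborel)"
      by (simp add: nn_integral_cmult)
    also have "(\<integral>\<^sup>+x. ennreal (G x) \<partial>lborel) = 1"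
      using gamma_rate_density_Laplace[of \<kappa> c 0] \<kappa> c by (simp add: G_def)
    finally show ?thesis using A_le by (simp add: le_less_trans)
  qed
  have young: "(\<integral>\<^sup>+x. ?\<phi> x * f x \<partial>lborel) \<le> ennreal (1 / r) * ?B + ennreal (1 - 1 / r) * ?A"
  proof -
    have "(\<integral>\<^sup>+x. ?\<phi> x * f x \<partial>lborel) \<le> (\<integral>\<^sup>+x. ennreal (1 / r) * ennreal (enn2real (f x) powr r) +
        ennreal (1 - 1 / r) * ennreal (if 0 < x then G (x + \<epsilon>) powr r else 0) \<partial>lborel)"
    proof (rule nn_integral_mono_AE, use f0 fin in eventually_elim)
      case (elim x)
      show ?case
      proof (cases "0 < x")
        case True
        define u where "u = enn2real (f x)"
        define v where "v = G (x + \<epsilon>)"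
        have fu: "f x = ennreal u" using elim by (simp add: u_def less_top)
        have "u * v powr (r - 1) \<le> u powr r / r + (v powr (r - 1)) powr (r / (r - 1)) / (r / (r - 1))"
          using r by (intro Youngs_inequality) (auto simp: u_def field_simps)
        also have "(v powr (r - 1)) powr (r / (r - 1)) / (r / (r - 1)) = (1 - 1 / r) * v powr r"
          using r by (simp add: powr_powr divide_simps)
        finally have "u * v powr (r - 1) \<le> 1 / r * u powr r + (1 - 1 / r) * v powr r"
          by simp
        then show ?thesis
          using True r unfolding v_def[symmetric] fu
          by (simp add: u_def mult.commute ennreal_leI flip: ennreal_mult' ennreal_plus)
      next
        case False
        then show ?thesis using elim by simp
      qed
    qed
    also have "\<dots> = ennreal (1 / r) * ?B + ennreal (1 - 1 / r) * ?A"
      unfolding G_def by (subst nn_integral_add) (auto simp: nn_integral_cmult)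
    finally show ?thesis .
  qed
  show ?thesis
  proof (cases "?B = \<infinity>")
    case False
    then obtain B where B: "?B = ennreal B" "0 \<le> B" by (cases ?B) auto
    obtain A where A: "?A = ennreal A" "0 \<le> A" using A_fin by (cases ?A) auto
    have "ennreal A \<le> ennreal (1 / r) * ennreal B + ennreal (1 - 1 / r) * ennreal A"
      using A_le comp young unfolding A(1) B(1) by (meson order_trans)
    then have "A \<le> 1 / r * B + (1 - 1 / r) * A"
      using r A B by (simp flip: ennreal_mult' ennreal_plus)
    then have "A \<le> B" using r by (simp add: field_simps)
    then show ?thesis unfolding A(1) B(1) by (rule ennreal_leI)
  qed auto
qed


lemma ln_ennreal_mono: "x \<le> y \<Longrightarrow> ln_ennreal x \<le> ln_ennreal y"
  by (cases x; cases y) (auto simp: ln_ennreal_def enn2real_positive_iff top_unique)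

text \<open>Fatou's lemma for \<open>\<epsilon> = 1 / (k + 1)\<close>. The left side may be infinite, and then so is the right side.\<close>

lemma gamma_norm_le:
  fixes f :: "real \<Rightarrow> ennreal"
  assumes [measurable]: "f \<in> borel_measurable borel"
    and f0: "AE x in lborel. x \<le> 0 \<longrightarrow> f x = 0" and fin: "AE x in lborel. f x \<noteq> \<infinity>"
    and \<kappa>: "0 < \<kappa>" "\<kappa> < 1" and c: "0 < c" and r: "1 < r"
    and lap: "\<And>s. 0 < s \<Longrightarrow> ennreal ((c / (c + s)) powr \<kappa>) \<le> (\<integral>\<^sup>+x. ennreal (exp (- s * x)) * f x \<partial>lborel)"
  shows "(\<integral>\<^sup>+x. ennreal (gamma_rate_density \<kappa> c x powr r) \<partial>lborel)
       \<le> (\<integral>\<^sup>+x. ennreal (enn2real (f x) powr r) \<partial>lborel)"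
proof -
  have "Gamma \<kappa> \<noteq> 0" using Gamma_real_pos[OF \<kappa>(1)] by linarith
  let ?G = "gamma_rate_density \<kappa> c"
  let ?e = "\<lambda>k::nat. inverse (real (Suc k))"
  let ?h = "\<lambda>k x. ennreal (if 0 < x then ?G (x + ?e k) powr r else 0)"
  have lim: "(\<lambda>k. ?h k x) \<longlonglongrightarrow> ennreal (?G x powr r)" for x
  proof (cases "0 < x")
    case True
    have e: "(\<lambda>k. x + ?e k) \<longlonglongrightarrow> x + 0"
      by (intro tendsto_intros LIMSEQ_inverse_real_of_nat)
    have "(\<lambda>k. c powr \<kappa> / Gamma \<kappa> * (x + ?e k) powr (\<kappa> - 1) * exp (- c * (x + ?e k))) \<longlonglongrightarrow>
        c powr \<kappa> / Gamma \<kappa> * (x + 0) powr (\<kappa> - 1) * exp (- c * (x + 0))"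
      using True by (intro tendsto_mult tendsto_const tendsto_powr tendsto_exp e) auto
    moreover have "0 < x + ?e k" for k using True by (simp add: add_pos_pos)
    ultimately have "(\<lambda>k. ?G (x + ?e k)) \<longlonglongrightarrow> ?G x"
      using True by (simp add: gamma_rate_density_def)
    moreover have "?G x \<noteq> 0"
      using True c \<open>Gamma \<kappa> \<noteq> 0\<close> by (simp add: gamma_rate_density_def)
    ultimately have "(\<lambda>k. ?G (x + ?e k) powr r) \<longlonglongrightarrow> ?G x powr r"
      by (intro tendsto_powr tendsto_const) auto
    then show ?thesis using True by (auto intro!: tendsto_ennrealI)
  qed (simp add: gamma_rate_density_def)
  have "(\<integral>\<^sup>+x. ennreal (?G x powr r) \<partial>lborel) = (\<integral>\<^sup>+x. liminf (\<lambda>k. ?h k x) \<partial>lborel)"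
    by (intro nn_integral_cong lim_imp_Liminf[symmetric] lim) simp
  also have "\<dots> \<le> liminf (\<lambda>k. \<integral>\<^sup>+x. ?h k x \<partial>lborel)"
    by (rule nn_integral_liminf) simp
  also have "\<dots> \<le> (\<integral>\<^sup>+x. ennreal (enn2real (f x) powr r) \<partial>lborel)"
  proof (rule Liminf_le[OF sequentially_bot])
    show "\<forall>\<^sub>F k in sequentially.
        (\<integral>\<^sup>+x. ?h k x \<partial>lborel) \<le> (\<integral>\<^sup>+x. ennreal (enn2real (f x) powr r) \<partial>lborel)"
      by (intro always_eventually allI shifted_gamma_norm_le[OF assms(1) f0 fin \<kappa> c r _ lap]) auto
  qed
  finally show ?thesis .
qed

text \<open>A bound \<open>K\<close> on \<open>f\<close> would give \<open>(c / (c + s)) powr \<kappa> \<le> K / s\<close> for all \<open>s > 0\<close>, which fails for large \<open>s\<close>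
  because \<open>\<kappa> < 1\<close>.\<close>

lemma esssup_top_of_Laplace_ge:
  fixes f :: "real \<Rightarrow> ennreal"
  assumes [measurable]: "f \<in> borel_measurable borel"
    and f0: "AE x in lborel. x \<le> 0 \<longrightarrow> f x = 0"
    and \<kappa>: "\<kappa> < 1" and c: "0 < c"
    and lap: "\<And>s. 0 < s \<Longrightarrow> ennreal ((c / (c + s)) powr \<kappa>) \<le> (\<integral>\<^sup>+x. ennreal (exp (- s * x)) * f x \<partial>lborel)"
  shows "esssup lborel f = \<infinity>"
proof (rule ccontr)
  assume "esssup lborel f \<noteq> \<infinity>"
  then obtain K where K: "esssup lborel f = ennreal K" "0 \<le> K"
    by (cases "esssup lborel f") auto
  have bound: "AE x in lborel. f x \<le> ennreal K"
    unfolding K(1)[symmetric] by (rule esssup_AE)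
  have le: "s * (c / (c + s)) powr \<kappa> \<le> K" if s: "0 < s" for s
  proof -
    \<comment> \<open>The factor \<open>x powr (1 - 1)\<close> puts the exponential integral in the form of Euler's integral.\<close>
    have "(\<integral>\<^sup>+x. ennreal (exp (- s * x)) * f x \<partial>lborel)
        \<le> (\<integral>\<^sup>+x. ennreal K * ennreal (if 0 < x then x powr (1 - 1) * exp (- s * x) else 0) \<partial>lborel)"
    proof (rule nn_integral_mono_AE, use f0 bound in eventually_elim)
      case (elim x)
      then show ?case
        by (cases "0 < x") (auto simp: mult.commute intro: mult_right_mono)
    qed
    also have "\<dots> = ennreal K * ennreal (Gamma 1 / s powr 1)"
      using s nn_integral_powr_exp[of 1 s] by (subst nn_integral_cmult) auto
    also have "\<dots> = ennreal (K / s)"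
      using s K(2) by (simp flip: ennreal_mult')
    finally have "ennreal ((c / (c + s)) powr \<kappa>) \<le> ennreal (K / s)"
      using lap[OF s] by (rule order_trans[rotated])
    then have "(c / (c + s)) powr \<kappa> \<le> K / s"
      using s K(2) by (simp add: ennreal_le_iff)
    then show ?thesis using s by (simp add: field_simps)
  qed
  have "filterlim (\<lambda>s. s * (c / (c + s)) powr \<kappa>) at_top at_top"
    using \<kappa> c by real_asymp
  then have "\<forall>\<^sub>F s in at_top. K < s * (c / (c + s)) powr \<kappa>"
    by (simp add: filterlim_at_top_dense)
  then have "\<forall>\<^sub>F s in at_top. K < s * (c / (c + s)) powr \<kappa> \<and> 0 < s"
    using eventually_gt_at_top[of 0] by (rule eventually_conj)
  then obtain s where "K < s * (c / (c + s)) powr \<kappa>" "0 < s"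
    using eventually_happens trivial_limit_at_top_linorder by blast
  then show False using le[of s] by linarith
qed

text \<open>A density on the half-line whose Laplace transform dominates that of a gamma law of shape below \<open>1\<close> is
  more concentrated than that law, at every order above \<open>1\<close>. This is the interface between the analysis and
  the weighted sums, which enter through their Laplace transforms.\<close>

lemma density_renyi_entropy_le_gamma:
  fixes f :: "real \<Rightarrow> ennreal"
  assumes f[measurable]: "f \<in> borel_measurable borel"
    and f0: "AE x in lborel. x \<le> 0 \<longrightarrow> f x = 0" and fin: "AE x in lborel. f x \<noteq> \<infinity>"
    and \<kappa>: "0 < \<kappa>" "\<kappa> < 1" and c: "0 < c" and \<alpha>: "1 < \<alpha>"
    and lap: "\<And>s. 0 < s \<Longrightarrow> ennreal ((c / (c + s)) powr \<kappa>) \<le> (\<integral>\<^sup>+x. ennreal (exp (- s * x)) * f x \<partial>lborel)"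
  shows "density_renyi_entropy \<alpha> f \<le> density_renyi_entropy \<alpha> (\<lambda>x. ennreal (gamma_rate_density \<kappa> c x))"
proof (cases "\<alpha> = \<infinity>")
  case True
  then show ?thesis
    using esssup_top_of_Laplace_ge[OF f f0 \<kappa>(2) c lap]
    by (simp add: density_renyi_entropy_def ln_ennreal_def)
next
  case False
  then obtain r where r: "\<alpha> = ereal r" "1 < r" using \<alpha> by (cases \<alpha>) auto
  let ?I = "\<lambda>g. ln_ennreal (\<integral>\<^sup>+x. ennreal (enn2real (g x) powr r) \<partial>lborel)"
  have "?I (\<lambda>x. ennreal (gamma_rate_density \<kappa> c x)) \<le> ?I f"
    using gamma_norm_le[OF f f0 fin \<kappa> c r(2) lap] gamma_rate_density_nonneg[OF \<kappa>(1), of c]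
    by (intro ln_ennreal_mono) simp
  then have "ereal (1 / (r - 1)) * ?I (\<lambda>x. ennreal (gamma_rate_density \<kappa> c x)) \<le> ereal (1 / (r - 1)) * ?I f"
    using r by (intro ereal_mult_left_mono) auto
  moreover have "ereal (1 / (1 - r)) * z = - (ereal (1 / (r - 1)) * z)" for z
  proof -
    have "ereal (1 / (1 - r)) = - ereal (1 / (r - 1))"
      using r by (simp add: field_simps)
    then show ?thesis by (simp only: ereal_mult_minus_left)
  qed
  ultimately show ?thesis
    using r by (simp add: density_renyi_entropy_def)
qed

section \<open>Sums of independent gamma variables\<close>

context prob_space
begin

text \<open>The entropy is read off from a Radon-Nikodym derivative of the law, so a sum with unequal weights must
  first be known to have a density.\<close>

lemma indep_sum_has_density:
  fixes Y :: "'i \<Rightarrow> 'a \<Rightarrow> real"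
  assumes "finite I" "I \<noteq> {}" "indep_vars (\<lambda>_. borel) Y I"
    and "\<And>i. i \<in> I \<Longrightarrow> \<exists>f. distributed M lborel (Y i) f"
  shows "\<exists>f. distributed M lborel (\<lambda>\<omega>. \<Sum>i\<in>I. Y i \<omega>) f"
  using assms
proof (induction rule: finite_ne_induct)
  case (insert i F)
  have "\<exists>f. distributed M lborel (\<lambda>\<omega>. \<Sum>i\<in>F. Y i \<omega>) f"
    using insert.prems by (intro insert.IH indep_vars_subset[OF insert.prems(1)]) auto
  moreover have "\<exists>f. distributed M lborel (Y i) f" using insert.prems by auto
  moreover have "indep_var borel (Y i) borel (\<lambda>\<omega>. \<Sum>i\<in>F. Y i \<omega>)"
    using insert by (intro indep_vars_sum) auto
  ultimately show ?case
    using insert.hyps by (auto dest: distributed_convolution)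
qed simp

lemma gamma_distributed_sum:
  fixes Y :: "'i \<Rightarrow> 'a \<Rightarrow> real"
  assumes "finite I" "I \<noteq> {}" "indep_vars (\<lambda>_. borel) Y I" and "0 < \<gamma>" "0 < c"
    and "\<And>i. i \<in> I \<Longrightarrow> distributed M lborel (Y i) (\<lambda>x. ennreal (gamma_rate_density \<gamma> c x))"
  shows "distributed M lborel (\<lambda>\<omega>. \<Sum>i\<in>I. Y i \<omega>)
           (\<lambda>x. ennreal (gamma_rate_density (real (card I) * \<gamma>) c x))"
  using assms
proof (induction rule: finite_ne_induct)
  case (insert i F)
  have "distributed M lborel (\<lambda>\<omega>. \<Sum>i\<in>F. Y i \<omega>)
      (\<lambda>x. ennreal (gamma_rate_density (real (card F) * \<gamma>) c x))"
    using insert.prems by (intro insert.IH indep_vars_subset[OF insert.prems(1)]) auto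
  moreover have "indep_var borel (Y i) borel (\<lambda>\<omega>. \<Sum>i\<in>F. Y i \<omega>)"
    using insert by (intro indep_vars_sum) auto
  ultimately have "distributed M lborel (\<lambda>\<omega>. Y i \<omega> + (\<Sum>i\<in>F. Y i \<omega>))
      (\<lambda>x. \<integral>\<^sup>+y. ennreal (gamma_rate_density \<gamma> c (x - y)) *
         ennreal (gamma_rate_density (real (card F) * \<gamma>) c y) \<partial>lborel)"
    using insert.prems by (intro distributed_convolution) auto
  moreover have "0 < real (card F) * \<gamma>"
    using insert by (auto simp: card_gt_0_iff)
  ultimately show ?case
    using insert by (simp add: gamma_rate_density_convolution algebra_simps)
qed simp

lemma gamma_distributed_scale:
  assumes "distributed M lborel X (\<lambda>x. ennreal (gamma_rate_density \<gamma> c x))" "0 < \<gamma>" "0 < c" "0 < t"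
  shows "distributed M lborel (\<lambda>\<omega>. t * X \<omega>) (\<lambda>x. ennreal (gamma_rate_density \<gamma> (c / t) x))"
proof -
  have "distributed M lborel (\<lambda>\<omega>. 0 + t * X \<omega>) (\<lambda>x. ennreal (gamma_rate_density \<gamma> c ((x - 0) / t)) / \<bar>t\<bar>)"
    using assms by (intro distributed_affine) auto
  moreover have "ennreal (gamma_rate_density \<gamma> c ((x - 0) / t)) / \<bar>t\<bar>
      = ennreal (gamma_rate_density \<gamma> (c / t) x)" for x
  proof -
    have "gamma_rate_density \<gamma> c (x / t) / t = gamma_rate_density \<gamma> (c / t) x"
      using assms by (auto simp: gamma_rate_density_def powr_divide powr_diff field_simps)
    then show ?thesis
      using assms by (simp add: divide_ennreal gamma_rate_density_nonneg)
  qed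
  ultimately show ?thesis by simp
qed

lemma gamma_distributed_Laplace:
  assumes "distributed M lborel X (\<lambda>x. ennreal (gamma_rate_density \<gamma> c x))" "0 < \<gamma>" "0 < c" "0 \<le> s"
  shows "(\<integral>\<^sup>+\<omega>. ennreal (exp (- s * X \<omega>)) \<partial>M) = ennreal ((c / (c + s)) powr \<gamma>)"
  using distributed_nn_integral[OF assms(1), of "\<lambda>x. ennreal (exp (- s * x))"]
    gamma_rate_density_Laplace[OF assms(2-4)]
  by (simp add: mult.commute)

lemma weighted_gamma_sum_Laplace:
  fixes X :: "'i \<Rightarrow> 'a \<Rightarrow> real"
  assumes "finite I" "indep_vars (\<lambda>_. borel) X I" "0 < \<gamma>" "0 \<le> s"
    and X: "\<And>i. i \<in> I \<Longrightarrow> distributed M lborel (X i) (\<lambda>x. ennreal (gamma_rate_density \<gamma> 1 x))"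
    and t: "\<And>i. i \<in> I \<Longrightarrow> 0 \<le> t i"
  shows "(\<integral>\<^sup>+\<omega>. ennreal (exp (- s * (\<Sum>i\<in>I. t i * X i \<omega>))) \<partial>M)
       = ennreal ((\<Prod>i\<in>I. 1 + s * t i) powr (- \<gamma>))"
proof -
  have "(\<integral>\<^sup>+\<omega>. ennreal (exp (- s * (\<Sum>i\<in>I. t i * X i \<omega>))) \<partial>M)
      = (\<integral>\<^sup>+\<omega>. (\<Prod>i\<in>I. ennreal (exp (- (s * t i) * X i \<omega>))) \<partial>M)"
    using assms(1) by (simp add: sum_distrib_left exp_sum prod_ennreal mult.assoc flip: sum_negf)
  also have "\<dots> = (\<Prod>i\<in>I. \<integral>\<^sup>+\<omega>. ennreal (exp (- (s * t i) * X i \<omega>)) \<partial>M)"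
    by (rule indep_vars_nn_integral[OF assms(1) indep_vars_compose2[OF assms(2)]]) auto
  also have "\<dots> = (\<Prod>i\<in>I. ennreal ((1 + s * t i) powr (- \<gamma>)))"
  proof (rule prod.cong[OF refl])
    fix i assume i: "i \<in> I"
    have "0 \<le> s * t i" using t[OF i] \<open>0 \<le> s\<close> by simp
    then show "(\<integral>\<^sup>+\<omega>. ennreal (exp (- (s * t i) * X i \<omega>)) \<partial>M) = ennreal ((1 + s * t i) powr (- \<gamma>))"
      using gamma_distributed_Laplace[OF X[OF i] \<open>0 < \<gamma>\<close>, of "s * t i"]
      by (simp add: powr_divide powr_minus_divide)
  qed
  also have "\<dots> = ennreal ((\<Prod>i\<in>I. 1 + s * t i) powr (- \<gamma>))"
    using t \<open>0 \<le> s\<close> by (simp add: prod_ennreal prod_powr_distrib)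
  finally show ?thesis .
qed

end

section \<open>Equal weights minimise the Laplace transform\<close>

text \<open>The tangent line bound \<open>y \<le> exp (y - 1)\<close>, applied to each factor divided by its value \<open>c\<close> at equal weights,
  reduces the claim to \<open>(\<Sum>i. sqrt (a i)) \<le> sqrt n\<close>, which is the Cauchy-Schwarz inequality.\<close>

lemma prod_one_plus_sqrt_le:
  fixes a :: "'i \<Rightarrow> real"
  assumes "finite I" "I \<noteq> {}" "\<And>i. i \<in> I \<Longrightarrow> 0 \<le> a i" "(\<Sum>i\<in>I. a i) = 1" "0 \<le> s"
  shows "(\<Prod>i\<in>I. 1 + s * sqrt (a i)) \<le> (1 + s / sqrt (real (card I))) ^ card I"
proof -
  define n where "n = card I"
  have n: "0 < n" using assms by (simp add: n_def card_gt_0_iff)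
  define c where "c = 1 + s / sqrt (real n)"
  have c: "0 < c" using assms n by (simp add: c_def add_pos_nonneg)
  have "(\<Sum>i\<in>I. 1 * sqrt (a i))\<^sup>2 \<le> (\<Sum>i\<in>I. 1\<^sup>2) * (\<Sum>i\<in>I. (sqrt (a i))\<^sup>2)"
    by (rule Cauchy_Schwarz_ineq_sum)
  then have "(\<Sum>i\<in>I. sqrt (a i))\<^sup>2 \<le> real n"
    using assms by (simp add: n_def)
  then have S: "(\<Sum>i\<in>I. sqrt (a i)) \<le> sqrt (real n)"
    by (rule real_le_rsqrt)
  have "(\<Prod>i\<in>I. (1 + s * sqrt (a i)) / c) \<le> (\<Prod>i\<in>I. exp ((1 + s * sqrt (a i)) / c - 1))"
  proof (rule prod_mono)
    fix i assume "i \<in> I"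
    then show "0 \<le> (1 + s * sqrt (a i)) / c \<and> (1 + s * sqrt (a i)) / c \<le> exp ((1 + s * sqrt (a i)) / c - 1)"
      using assms c exp_ge_add_one_self[of "(1 + s * sqrt (a i)) / c - 1"] by auto
  qed
  also have "\<dots> = exp ((real n + s * (\<Sum>i\<in>I. sqrt (a i))) / c - real n)"
    using assms by (simp add: exp_sum[symmetric] sum_subtractf sum.distrib n_def
      flip: sum_divide_distrib sum_distrib_left)
  also have "\<dots> \<le> 1"
  proof -
    have "s * (\<Sum>i\<in>I. sqrt (a i)) \<le> s * sqrt (real n)"
      using S assms by (intro mult_left_mono) auto
    also have "s * sqrt (real n) = real n * (s / sqrt (real n))"
      using n by (simp add: field_simps)
    finally have "real n + s * (\<Sum>i\<in>I. sqrt (a i)) \<le> real n * c"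
      by (simp add: c_def algebra_simps)
    then show ?thesis using c by (simp add: field_simps)
  qed
  finally have "(\<Prod>i\<in>I. 1 + s * sqrt (a i)) / c ^ n \<le> 1"
    by (simp add: prod_dividef n_def)
  then show ?thesis
    using c by (simp add: n_def c_def field_simps)
qed

section \<open>Comparison of the entropies\<close>

theorem corollary4:
  fixes \<gamma> :: real and n :: nat and M :: "'a measure" and X :: "nat \<Rightarrow> 'a \<Rightarrow> real"
    and \<alpha> :: ereal and a :: "nat \<Rightarrow> real"
  assumes "0 < \<gamma>"
    and "1 \<le> n"
    and "real n * \<gamma> < 1"
    and "prob_space M"
    and "prob_space.indep_vars M (\<lambda>_. borel) X {1..n}"
    and "\<And>j. j \<in> {1..n} \<Longrightarrow> distributed M lborel (X j) (\<lambda>x. ennreal (gamma_density \<gamma> x))"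
    and "1 < \<alpha>"
    and "\<And>j. j \<in> {1..n} \<Longrightarrow> 0 \<le> a j"
    and "(\<Sum>j = 1..n. a j) = 1"
  shows "renyi_entropy \<alpha> M (\<lambda>\<omega>. \<Sum>j = 1..n. sqrt (a j) * X j \<omega>)
      \<le> renyi_entropy \<alpha> M (\<lambda>\<omega>. \<Sum>j = 1..n. 1 / sqrt (real n) * X j \<omega>)"
proof -
  interpret prob_space M by fact
  define I where "I = {1..n}"
  have I: "finite I" "I \<noteq> {}" "card I = n" using assms(2) by (auto simp: I_def)
  have ind: "indep_vars (\<lambda>_. borel) X I" using assms(5) by (simp add: I_def)
  have X: "distributed M lborel (X j) (\<lambda>x. ennreal (gamma_rate_density \<gamma> 1 x))" if "j \<in> I" for j
    using assms(6)[of j] that by (simp add: I_def gamma_density_eq_gamma_rate_density)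
  have a: "0 \<le> a j" if "j \<in> I" for j using assms(8) that by (simp add: I_def)
  have sum_a: "(\<Sum>j\<in>I. a j) = 1" using assms(9) by (simp add: I_def)
  let ?c = "sqrt (real n)" and ?\<kappa> = "real n * \<gamma>"
  let ?S = "\<lambda>\<omega>. \<Sum>j\<in>I. sqrt (a j) * X j \<omega>"
  have c: "0 < ?c" and \<kappa>: "0 < ?\<kappa>" using assms(1,2) by auto

  have "distributed M lborel (\<lambda>\<omega>. \<Sum>j\<in>I. 1 / ?c * X j \<omega>)
      (\<lambda>x. ennreal (gamma_rate_density (real (card I) * \<gamma>) ?c x))"
  proof (rule gamma_distributed_sum[OF I(1,2) _ assms(1) c])
    show "indep_vars (\<lambda>_. borel) (\<lambda>j \<omega>. 1 / ?c * X j \<omega>) I"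
      by (rule indep_vars_compose2[OF ind]) simp
    show "distributed M lborel (\<lambda>\<omega>. 1 / ?c * X j \<omega>) (\<lambda>x. ennreal (gamma_rate_density \<gamma> ?c x))"
      if "j \<in> I" for j
      using gamma_distributed_scale[OF X[OF that] assms(1), of "1 / ?c"] c by simp
  qed
  then have equal: "renyi_entropy \<alpha> M (\<lambda>\<omega>. \<Sum>j\<in>I. 1 / ?c * X j \<omega>)
      = density_renyi_entropy \<alpha> (\<lambda>x. ennreal (gamma_rate_density ?\<kappa> ?c x))"
    unfolding I(3) by (rule renyi_entropy_distributed)

  \<comment> \<open>A term of weight \<open>0\<close> has no density, so the density of the sum is built from the positive
    weights alone; these exist since the weights sum to \<open>1\<close>.\<close>
  define J where "J = {j \<in> I. 0 < a j}"
  have J: "finite J" "J \<subseteq> I" using I by (auto simp: J_def)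
  have "J \<noteq> {}"
  proof
    assume "J = {}"
    then have "a j = 0" if "j \<in> I" for j
      using a[OF that] that by (auto simp: J_def order.order_iff_strict)
    then show False using sum_a by simp
  qed
  have "\<exists>f. distributed M lborel (\<lambda>\<omega>. \<Sum>j\<in>J. sqrt (a j) * X j \<omega>) f"
  proof (rule indep_sum_has_density[OF J(1) \<open>J \<noteq> {}\<close>])
    show "indep_vars (\<lambda>_. borel) (\<lambda>j \<omega>. sqrt (a j) * X j \<omega>) J"
      by (rule indep_vars_compose2[OF indep_vars_subset[OF ind J(2)]]) simp
    show "\<exists>f. distributed M lborel (\<lambda>\<omega>. sqrt (a j) * X j \<omega>) f" if "j \<in> J" for j
      using gamma_distributed_scale[OF X assms(1), of j "sqrt (a j)"] that by (auto simp: J_def)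
  qed
  moreover have "(\<Sum>j\<in>J. sqrt (a j) * X j \<omega>) = ?S \<omega>" for \<omega>
    using I a by (intro sum.mono_neutral_left) (auto simp: J_def order.order_iff_strict)
  ultimately obtain f where f: "distributed M lborel ?S f" by auto
  have f_meas[measurable]: "f \<in> borel_measurable borel"
    using f by (simp add: distributed_def)
  have prob: "(\<integral>\<^sup>+x. f x \<partial>lborel) = 1"
    using distributed_nn_integral[OF f, of "\<lambda>_. 1"] by (simp add: emeasure_space_1)
  have fin: "AE x in lborel. f x \<noteq> \<infinity>"
    using prob by (intro nn_integral_PInf_AE) auto
  have f0: "AE x in lborel. x \<le> 0 \<longrightarrow> f x = 0"
  proof -
    have "AE \<omega> in M. \<forall>j\<in>I. 0 \<le> X j \<omega>"
    proof (rule AE_finite_allI[OF I(1)])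
      fix j assume "j \<in> I"
      show "AE \<omega> in M. 0 \<le> X j \<omega>"
        using distributed_AE2[OF X[OF \<open>j \<in> I\<close>], of "\<lambda>x. 0 \<le> x"]
        by (simp add: gamma_rate_density_def)
    qed
    then have "AE \<omega> in M. 0 \<le> ?S \<omega>"
      by eventually_elim (auto intro!: sum_nonneg mult_nonneg_nonneg simp: a)
    then have "AE x in lborel. 0 < f x \<longrightarrow> 0 \<le> x"
      using distributed_AE2[OF f, of "\<lambda>x. 0 \<le> x"] by simp
    moreover have "AE x in lborel. x \<noteq> (0::real)"
      by (rule AE_lborel_singleton)
    ultimately show ?thesis
      by eventually_elim (auto simp: zero_less_iff_neq_zero)
  qed
  have lap: "ennreal ((?c / (?c + s)) powr ?\<kappa>) \<le> (\<integral>\<^sup>+x. ennreal (exp (- s * x)) * f x \<partial>lborel)"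
    if s: "0 < s" for s
  proof -
    let ?P = "\<Prod>j\<in>I. 1 + s * sqrt (a j)"
    have P: "0 < ?P" using a s by (intro prod_pos) (auto simp: add_pos_nonneg)
    have "?P \<le> (1 + s / ?c) ^ n"
      using prod_one_plus_sqrt_le[OF I(1,2) a sum_a, of s] s I(3) by simp
    then have "((1 + s / ?c) ^ n) powr (- \<gamma>) \<le> ?P powr (- \<gamma>)"
      using P assms(1) by (intro powr_mono2') auto
    moreover have "((1 + s / ?c) ^ n) powr (- \<gamma>) = (?c / (?c + s)) powr ?\<kappa>"
    proof -
      have p: "0 < 1 + s / ?c" using s c by (simp add: add_pos_pos)
      have "((1 + s / ?c) ^ n) powr (- \<gamma>) = (1 + s / ?c) powr (- ?\<kappa>)"
        using p by (simp add: powr_powr flip: powr_realpow)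
      also have "\<dots> = (1 / (1 + s / ?c)) powr ?\<kappa>"
        using p by (simp add: powr_divide powr_minus_divide)
      also have "1 / (1 + s / ?c) = ?c / (?c + s)"
        using c s by (simp add: field_simps)
      finally show ?thesis .
    qed
    ultimately have "ennreal ((?c / (?c + s)) powr ?\<kappa>) \<le> ennreal (?P powr (- \<gamma>))"
      by (simp add: ennreal_leI)
    also have "\<dots> = (\<integral>\<^sup>+\<omega>. ennreal (exp (- s * ?S \<omega>)) \<partial>M)"
      using weighted_gamma_sum_Laplace[OF I(1) ind assms(1) _ X, of s "\<lambda>j. sqrt (a j)"] s a by simp
    also have "\<dots> = (\<integral>\<^sup>+x. ennreal (exp (- s * x)) * f x \<partial>lborel)"
      using distributed_nn_integral[OF f, of "\<lambda>x. ennreal (exp (- s * x))"] by (simp add: mult.commute)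
    finally show ?thesis .
  qed
  have "renyi_entropy \<alpha> M ?S \<le> renyi_entropy \<alpha> M (\<lambda>\<omega>. \<Sum>j\<in>I. 1 / ?c * X j \<omega>)"
    unfolding equal renyi_entropy_distributed[OF f]
    by (rule density_renyi_entropy_le_gamma[OF f_meas f0 fin \<kappa> assms(3) c assms(7) lap])
  then show ?thesis by (simp add: I_def)
qed

end
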